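(* Let $n\ge 3$, let $s\in(0,1)$ and let $\Omega\subseteq\mathbb{R}^n$ be an arbitrary nonempty open set. Then $$\mathcal{S}_{n,s}(\Omega)=\mathcal{S}_n .$$
   Context: Let $2^*:=\frac{2n}{n-2}$. For measurable $u:\mathbb{R}^n\to\mathbb{R}$ set $[u]_s:=\Big(\iint_{\mathbb{R}^{2n}}\frac{|u(x)-u(y)|^2}{|x-y|^{n+2s}}\,dx\,dy\Big)^{1/2}$ (Gagliardo seminorm). For $u\in C_0^\infty(\Omega)$ (smooth real functions with compact support in $\Omega$, extended by zero to $\mathbb{R}^n$) set $\rho(u)^2:=\|\nabla u\|_{L^2(\mathbb{R}^n)}^2+[u]_s^2$. $\mathcal{S}_{n,s}(\Omega)$ is the largest constant for which $\mathcal{S}_{n,s}(\Omega)\|u\|^2_{L^{2^*}(\mathbb{R}^n)}\le \rho(u)^2$ holds for all $u\in C_0^\infty(\Omega)$, that is, $$\mathcal{S}_{n,s}(\Omega)=\inf\{\rho(u)^2: u\in C_0^\infty(\Omega),\ \|u\|_{L^{2^*}(\mathbb{R}^n)}=1\}.$$ $\mathcal{S}_n$ is the best constant in the classical Sobolev inequality, $$\mathcal{S}_n=\inf\{\|\nabla u\|^2_{L^2(\mathbb{R}^n)}: u\in C_0^\infty(\mathbb{R}^n),\ \|u\|_{L^{2^*}(\mathbb{R}^n)}=1\},$$ which depends only on $n$ (the same value is obtained with $C_0^\infty(\Omega)$ in place of $C_0^\infty(\mathbb{R}^n)$ for any nonempty open $\Omega$). *)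

theory Defs
  imports "HOL-Analysis.Analysis"
begin

definition partial_deriv :: "'n::finite \<Rightarrow> (real^'n \<Rightarrow> real) \<Rightarrow> real^'n \<Rightarrow> real" where
  "partial_deriv i u x = frechet_derivative u (at x) (axis i 1)"

definition grad :: "(real^'n \<Rightarrow> real) \<Rightarrow> real^'n::finite \<Rightarrow> real^'n" where
  "grad u x = (\<chi> i. partial_deriv i u x)"

primrec C_class :: "nat \<Rightarrow> (real^'n::finite \<Rightarrow> real) \<Rightarrow> bool" where
  "C_class 0 u \<longleftrightarrow> continuous_on UNIV u"
| "C_class (Suc k) u \<longleftrightarrow> u differentiable_on UNIV \<and> (\<forall>i. C_class k (partial_deriv i u))"

definition smooth :: "(real^'n::finite \<Rightarrow> real) \<Rightarrow> bool" where
  "smooth u \<longleftrightarrow> (\<forall>k. C_class k u)"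

text \<open>Test functions on \<open>\<Omega>\<close> are represented by their extensions by zero: smooth functions on
  the whole space whose support is a compact subset of \<open>\<Omega>\<close>.\<close>

definition Cc_infinity :: "(real^'n::finite) set \<Rightarrow> (real^'n \<Rightarrow> real) set" where
  "Cc_infinity \<Omega> = {u. smooth u \<and> compact (closure {x. u x \<noteq> 0}) \<and> closure {x. u x \<noteq> 0} \<subseteq> \<Omega>}"

text \<open>Norms and seminorms take values in \<open>[0, \<infinity>]\<close>, so that a divergent integral has the value
  \<open>\<infinity>\<close>. The power \<open>epowr\<close> is meant for exponents \<open>p > 0\<close> only.\<close>

definition epowr :: "ennreal \<Rightarrow> real \<Rightarrow> ennreal" where
  "epowr x p = (if x = \<infinity> then \<infinity> else ennreal (enn2real x powr p))"

definition Lp_norm :: "real \<Rightarrow> (real^'n::finite \<Rightarrow> 'b::real_normed_vector) \<Rightarrow> ennreal" where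
  "Lp_norm p f = epowr (\<integral>\<^sup>+x. ennreal (norm (f x) powr p) \<partial>lborel) (1 / p)"

text \<open>The integrand has the value \<open>0\<close> on the diagonal, which is a null set.\<close>

definition gagliardo :: "real \<Rightarrow> (real^'n::finite \<Rightarrow> real) \<Rightarrow> ennreal" where
  "gagliardo s u =
     epowr (\<integral>\<^sup>+(x, y). ennreal (\<bar>u x - u y\<bar>\<^sup>2 / norm (x - y) powr (real CARD('n) + 2 * s))
              \<partial>(lborel \<Otimes>\<^sub>M lborel)) (1 / 2)"

definition rho_sq :: "real \<Rightarrow> (real^'n::finite \<Rightarrow> real) \<Rightarrow> ennreal" where
  "rho_sq s u = (Lp_norm 2 (grad u))\<^sup>2 + (gagliardo s u)\<^sup>2"

definition crit_exp :: "'n::finite itself \<Rightarrow> real" where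
  "crit_exp _ = 2 * real CARD('n) / (real CARD('n) - 2)"

definition mixed_sobolev_const :: "real \<Rightarrow> (real^'n::finite) set \<Rightarrow> ennreal" where
  "mixed_sobolev_const s \<Omega> =
     Inf {rho_sq s u |u. u \<in> Cc_infinity \<Omega> \<and> Lp_norm (crit_exp TYPE('n)) u = 1}"

definition sobolev_const :: "'n::finite itself \<Rightarrow> ennreal" where
  "sobolev_const _ =
     Inf {(Lp_norm 2 (grad u))\<^sup>2 |u :: real^'n \<Rightarrow> real.
            u \<in> Cc_infinity UNIV \<and> Lp_norm (crit_exp TYPE('n)) u = 1}"

end

theory Submission
  imports Defs
begin

text \<open>
  The two terms of \<open>\<rho>(u)\<^sup>2\<close> scale differently, and concentrating a test function makes the nonlocal
  term negligible. Write \<open>n\<close> for the dimension, \<open>2\<^sup>*\<close> for the critical exponent \<open>2n/(n - 2)\<close> and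
  \<open>[u]\<^sub>s\<close> for the Gagliardo seminorm. For \<open>l > 0\<close> put
  \<open>v x = l powr (- (n - 2) / 2) * u ((x - a) / l)\<close>. The exponent \<open>2\<^sup>*\<close> is the one for which
  both the norm of \<open>u\<close> in the Lebesgue space of exponent \<open>2\<^sup>*\<close> and the \<open>L\<^sup>2\<close>-norm of the gradient are
  unchanged (\<open>Lp_norm_dilate\<close>), whereas \<open>[v]\<^sub>s\<^sup>2 = l powr (2 - 2 * s) * [u]\<^sub>s\<^sup>2\<close> (\<open>gagliardo_dilate\<close>), which
  tends to \<open>0\<close> as \<open>l\<close> does because \<open>s < 1\<close>. If \<open>a \<in> \<Omega>\<close>, then \<open>v\<close> is supported in \<open>\<Omega>\<close> for small \<open>l\<close>.
  So every competitor \<open>u\<close> for the classical constant yields competitors on \<open>\<Omega>\<close> whose energy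
  \<open>\<rho>(v)\<^sup>2\<close> tends to the Dirichlet energy of \<open>u\<close>. This gives \<open>\<le>\<close>. The inequality \<open>\<ge>\<close> is immediate:
  there are fewer competitors on \<open>\<Omega>\<close>, and each has one more nonnegative term in its energy.

  The limit needs \<open>[u]\<^sub>s\<close> to be finite for a test function (\<open>gagliardo_finite\<close>). The integrand is
  controlled near the diagonal by a Lipschitz bound and away from it by a sup bound. What remains
  is the integrability of \<open>norm z powr (2 - 2 * s - n)\<close> on the unit ball and of
  \<open>norm z powr (- 2 * s - n)\<close> outside it. Both follow from one computation on dyadic annuli: by
  scaling, the integrals over the annuli form a geometric series.
\<close>

section \<open>Dilation of integrals and test functions\<close>

lemma nn_integral_affine:
  fixes g :: "'a::euclidean_space \<Rightarrow> ennreal"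
  assumes [measurable]: "g \<in> borel_measurable borel" and "l \<noteq> 0"
  shows "(\<integral>\<^sup>+x. g x \<partial>lborel) = ennreal (\<bar>l\<bar> ^ DIM('a)) * (\<integral>\<^sup>+x. g (t + l *\<^sub>R x) \<partial>lborel)"
  by (subst lborel_affine[OF assms(2), of t])
     (simp add: nn_integral_density nn_integral_distr nn_integral_cmult)

lemma nn_integral_dilate:
  fixes f :: "'a::euclidean_space \<Rightarrow> ennreal"
  assumes [measurable]: "f \<in> borel_measurable borel" and "l > 0"
  shows "(\<integral>\<^sup>+x. f ((x - a) /\<^sub>R l) \<partial>lborel) = ennreal (l ^ DIM('a)) * (\<integral>\<^sup>+x. f x \<partial>lborel)"
  using nn_integral_affine[of "\<lambda>x. f ((x - a) /\<^sub>R l)" l a] assms(2) by simp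

lemma nn_integral_lborel_pair_iterated:
  fixes f :: "'a::euclidean_space \<Rightarrow> 'a \<Rightarrow> ennreal"
  assumes "case_prod f \<in> borel_measurable (borel \<Otimes>\<^sub>M borel)"
  shows "(\<integral>\<^sup>+(x, y). f x y \<partial>(lborel \<Otimes>\<^sub>M lborel)) = (\<integral>\<^sup>+x. \<integral>\<^sup>+y. f x y \<partial>lborel \<partial>lborel)"
    and "(\<integral>\<^sup>+(x, y). f x y \<partial>(lborel \<Otimes>\<^sub>M lborel)) = (\<integral>\<^sup>+y. \<integral>\<^sup>+x. f x y \<partial>lborel \<partial>lborel)"
proof -
  have meas: "case_prod f \<in> borel_measurable (lborel \<Otimes>\<^sub>M lborel)"
    using assms
    by (simp add: measurable_cong_sets[OF sets_pair_measure_cong[OF sets_lborel sets_lborel] refl])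
  show "(\<integral>\<^sup>+(x, y). f x y \<partial>(lborel \<Otimes>\<^sub>M lborel)) = (\<integral>\<^sup>+x. \<integral>\<^sup>+y. f x y \<partial>lborel \<partial>lborel)"
    using lborel.nn_integral_fst[OF meas] by simp
  show "(\<integral>\<^sup>+(x, y). f x y \<partial>(lborel \<Otimes>\<^sub>M lborel)) = (\<integral>\<^sup>+y. \<integral>\<^sup>+x. f x y \<partial>lborel \<partial>lborel)"
    using lborel_pair.nn_integral_snd[OF meas] by simp
qed

lemma nn_integral_dilate_pair:
  fixes f :: "'a::euclidean_space \<Rightarrow> 'a \<Rightarrow> ennreal"
  assumes f: "case_prod f \<in> borel_measurable (borel \<Otimes>\<^sub>M borel)" and l: "l > 0"
  shows "(\<integral>\<^sup>+(x, y). f ((x - a) /\<^sub>R l) ((y - a) /\<^sub>R l) \<partial>(lborel \<Otimes>\<^sub>M lborel)) =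
    ennreal (l ^ (2 * DIM('a))) * (\<integral>\<^sup>+(x, y). f x y \<partial>(lborel \<Otimes>\<^sub>M lborel))"
proof -
  have f_dil: "(\<lambda>(x, y). f ((x - a) /\<^sub>R l) ((y - a) /\<^sub>R l)) \<in> borel_measurable (borel \<Otimes>\<^sub>M borel)"
    using measurable_compose[OF _ f, of "\<lambda>(x, y). ((x - a) /\<^sub>R l, (y - a) /\<^sub>R l)" "borel \<Otimes>\<^sub>M borel"]
    by (simp add: case_prod_beta)
  have f_section: "f x \<in> borel_measurable borel" for x
    using measurable_compose[OF _ f, of "\<lambda>y. (x, y)" borel] by simp
  define F where "F x = (\<integral>\<^sup>+y. f x y \<partial>lborel)" for x
  have F: "F \<in> borel_measurable borel"
    using lborel.borel_measurable_nn_integral[of f borel] f by (simp add: F_def[abs_def])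
  have F_dil: "(\<lambda>x. F ((x - a) /\<^sub>R l)) \<in> borel_measurable borel"
    using measurable_compose[OF _ F, of "\<lambda>x. (x - a) /\<^sub>R l" borel] by simp
  have "(\<integral>\<^sup>+(x, y). f ((x - a) /\<^sub>R l) ((y - a) /\<^sub>R l) \<partial>(lborel \<Otimes>\<^sub>M lborel)) =
      (\<integral>\<^sup>+x. ennreal (l ^ DIM('a)) * F ((x - a) /\<^sub>R l) \<partial>lborel)"
    unfolding nn_integral_lborel_pair_iterated(1)[OF f_dil] F_def
    using nn_integral_dilate[OF f_section l] by simp
  also have "\<dots> = ennreal (l ^ DIM('a)) * (ennreal (l ^ DIM('a)) * (\<integral>\<^sup>+x. F x \<partial>lborel))"
    using F_dil by (simp add: nn_integral_cmult nn_integral_dilate[OF F l])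
  also have "\<dots> = ennreal (l ^ (2 * DIM('a))) * (\<integral>\<^sup>+(x, y). f x y \<partial>(lborel \<Otimes>\<^sub>M lborel))"
    using l unfolding nn_integral_lborel_pair_iterated(1)[OF f] F_def
    by (simp add: mult.assoc[symmetric] ennreal_mult[symmetric] power_add[symmetric] mult_2)
  finally show ?thesis .
qed

lemma partial_deriv_dilate:
  fixes u :: "real^'n::finite \<Rightarrow> real"
  assumes "u differentiable_on UNIV"
  shows "partial_deriv i (\<lambda>x. c * u ((x - a) /\<^sub>R l)) =
    (\<lambda>x. (c / l) * partial_deriv i u ((x - a) /\<^sub>R l))"
proof
  fix x
  let ?D = "frechet_derivative u (at ((x - a) /\<^sub>R l))"
  have d: "(u has_derivative ?D) (at ((x - a) /\<^sub>R l))"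
    using assms by (simp add: differentiable_on_def frechet_derivative_works[symmetric])
  have "((\<lambda>x. u ((x - a) /\<^sub>R l)) has_derivative (\<lambda>h. ?D (h /\<^sub>R l))) (at x)"
    by (rule has_derivative_compose[of "\<lambda>x. (x - a) /\<^sub>R l" "\<lambda>h. h /\<^sub>R l" x UNIV u, OF _ d])
       (auto intro!: derivative_eq_intros)
  then have "((\<lambda>x. c * u ((x - a) /\<^sub>R l)) has_derivative (\<lambda>h. c * ?D (h /\<^sub>R l))) (at x)"
    by (rule has_derivative_mult_right)
  then have "frechet_derivative (\<lambda>x. c * u ((x - a) /\<^sub>R l)) (at x) = (\<lambda>h. c * ?D (h /\<^sub>R l))"
    by (rule frechet_derivative_at[symmetric])
  moreover have "linear ?D"
    using d by (rule has_derivative_linear)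
  ultimately show "partial_deriv i (\<lambda>x. c * u ((x - a) /\<^sub>R l)) x =
      (c / l) * partial_deriv i u ((x - a) /\<^sub>R l)"
    by (simp add: partial_deriv_def linear_scale divide_inverse)
qed

text \<open>The induction on the order of smoothness passes to the partial derivatives, which are dilates of
  those of \<open>u\<close> with the new factor \<open>c / l\<close>; this is why \<open>c\<close> has to vary in the induction.\<close>

lemma C_class_dilate:
  fixes u :: "real^'n::finite \<Rightarrow> real"
  assumes "C_class k u"
  shows "C_class k (\<lambda>x. c * u ((x - a) /\<^sub>R l))"
  using assms
proof (induction k arbitrary: u c)
  case 0
  then show ?case
    by (auto intro!: continuous_intros continuous_on_compose2[of UNIV u])
next
  case (Suc k)
  have "(\<lambda>x. u ((x - a) /\<^sub>R l)) differentiable_on UNIV"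
    using Suc.prems
    by (intro differentiable_on_compose[of "\<lambda>x. (x - a) /\<^sub>R l" _ u, unfolded o_def])
       (auto intro!: derivative_intros intro: differentiable_at_withinI simp: differentiable_on_def)
  moreover have "C_class k (partial_deriv i (\<lambda>x. c * u ((x - a) /\<^sub>R l)))" for i
    using Suc by (simp add: partial_deriv_dilate del: times_divide_eq_left)
  ultimately show ?case
    by (auto intro!: derivative_intros)
qed

lemma smooth_continuous: "smooth u \<Longrightarrow> continuous_on UNIV u"
  unfolding smooth_def by (metis C_class.simps(1))

lemma smooth_differentiable: "smooth u \<Longrightarrow> u differentiable_on UNIV"
  unfolding smooth_def by (metis C_class.simps(2))

lemma smooth_partial_deriv: "smooth u \<Longrightarrow> smooth (partial_deriv i u)"
  unfolding smooth_def by (metis C_class.simps(2))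

lemma smooth_grad_continuous: "smooth u \<Longrightarrow> continuous_on UNIV (grad u)"
  unfolding grad_def
  by (intro continuous_on_vec_lambda smooth_continuous smooth_partial_deriv)

lemma grad_dilate:
  assumes "u differentiable_on UNIV"
  shows "grad (\<lambda>x. c * u ((x - a) /\<^sub>R l)) x = (c / l) *\<^sub>R grad u ((x - a) /\<^sub>R l)"
  by (simp add: grad_def partial_deriv_dilate[OF assms] vec_eq_iff)

lemma Cc_infinity_dilate:
  fixes u :: "real^'n::finite \<Rightarrow> real"
  assumes u: "u \<in> Cc_infinity UNIV" and R: "\<And>x. u x \<noteq> 0 \<Longrightarrow> norm x \<le> R"
    and l: "l > 0" and sub: "cball a (l * R) \<subseteq> \<Omega>"
  shows "(\<lambda>x. c * u ((x - a) /\<^sub>R l)) \<in> Cc_infinity \<Omega>"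
proof -
  have "{x. c * u ((x - a) /\<^sub>R l) \<noteq> 0} \<subseteq> cball a (l * R)"
  proof
    fix x assume "x \<in> {x. c * u ((x - a) /\<^sub>R l) \<noteq> 0}"
    then have "u ((x - a) /\<^sub>R l) \<noteq> 0" by auto
    then have "norm ((x - a) /\<^sub>R l) \<le> R" by (rule R)
    then have "norm (x - a) / l \<le> R" using l by (simp add: divide_inverse mult.commute)
    then show "x \<in> cball a (l * R)"
      using l by (simp add: dist_norm norm_minus_commute pos_divide_le_eq mult.commute)
  qed
  then have c: "closure {x. c * u ((x - a) /\<^sub>R l) \<noteq> 0} \<subseteq> cball a (l * R)"
    by (rule closure_minimal) simp
  then have "compact (closure {x. c * u ((x - a) /\<^sub>R l) \<noteq> 0})"
    by (meson bounded_cball bounded_subset closed_closure compact_eq_bounded_closed)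
  then show ?thesis
    using u c sub by (auto simp: Cc_infinity_def smooth_def intro: C_class_dilate)
qed

section \<open>The critical scaling\<close>

lemma epowr_half_squared: "(epowr x (1 / 2))\<^sup>2 = x"
  by (cases x) (auto simp: epowr_def ennreal_power powr_half_sqrt power2_eq_square ennreal_mult_top
    ennreal_mult[symmetric])

text \<open>The substitution produces the Jacobian \<open>l ^ n\<close>, and the hypothesis on \<open>c\<close> says that the amplitude
  compensates it exactly. It is applied to \<open>u\<close> with the critical exponent and to \<open>grad u\<close> with exponent
  \<open>2\<close>, hence the general codomain.\<close>

lemma Lp_norm_dilate:
  fixes v w :: "real^'n::finite \<Rightarrow> 'b::real_normed_vector"
  assumes v: "continuous_on UNIV v" and l: "l > 0"
    and c: "l ^ CARD('n) * \<bar>c\<bar> powr p = 1"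
    and w: "\<And>x. w x = c *\<^sub>R v ((x - a) /\<^sub>R l)"
  shows "Lp_norm p w = Lp_norm p v"
proof -
  have [measurable]: "(\<lambda>x. norm (v x)) \<in> borel_measurable borel"
    by (intro borel_measurable_continuous_onI continuous_intros v)
  have "(\<integral>\<^sup>+x. ennreal (norm (w x) powr p) \<partial>lborel) =
      (\<integral>\<^sup>+x. ennreal (\<bar>c\<bar> powr p * norm (v ((x - a) /\<^sub>R l)) powr p) \<partial>lborel)"
    by (simp add: w powr_mult)
  also have "\<dots> = ennreal (l ^ CARD('n)) * (\<integral>\<^sup>+x. ennreal (\<bar>c\<bar> powr p * norm (v x) powr p) \<partial>lborel)"
    using nn_integral_dilate[of "\<lambda>x. ennreal (\<bar>c\<bar> powr p * norm (v x) powr p)" l a] l by simp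
  also have "\<dots> = ennreal (l ^ CARD('n) * \<bar>c\<bar> powr p) * (\<integral>\<^sup>+x. ennreal (norm (v x) powr p) \<partial>lborel)"
    using l by (simp add: ennreal_mult nn_integral_cmult mult.assoc)
  finally show ?thesis
    by (simp add: c Lp_norm_def)
qed

text \<open>The double integral contributes \<open>l ^ (2 * n)\<close> and the kernel \<open>l powr (- n - 2 * s)\<close>; together
  they leave \<open>l powr (n - 2 * s)\<close>.\<close>

lemma gagliardo_dilate:
  fixes u :: "real^'n::finite \<Rightarrow> real"
  assumes u: "continuous_on UNIV u" and l: "l > 0"
  shows "(gagliardo s (\<lambda>x. c * u ((x - a) /\<^sub>R l)))\<^sup>2 =
    ennreal (c\<^sup>2 * l powr (real CARD('n) - 2 * s)) * (gagliardo s u)\<^sup>2"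
proof -
  let ?q = "real CARD('n) + 2 * s"
  define f where "f x y = ennreal (\<bar>u x - u y\<bar>\<^sup>2 / norm (x - y) powr ?q)" for x y :: "real^'n"
  have [measurable]: "u \<in> borel_measurable borel"
    by (intro borel_measurable_continuous_onI u)
  have meas[measurable]: "case_prod f \<in> borel_measurable (borel \<Otimes>\<^sub>M borel)"
    unfolding f_def by measurable
  have eq: "\<bar>c * u ((x - a) /\<^sub>R l) - c * u ((y - a) /\<^sub>R l)\<bar>\<^sup>2 / norm (x - y) powr ?q =
      (c\<^sup>2 * l powr (- ?q)) * (\<bar>u ((x - a) /\<^sub>R l) - u ((y - a) /\<^sub>R l)\<bar>\<^sup>2
         / norm ((x - a) /\<^sub>R l - (y - a) /\<^sub>R l) powr ?q)" for x y :: "real^'n"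
  proof -
    have "(x - a) /\<^sub>R l - (y - a) /\<^sub>R l = (x - y) /\<^sub>R l"
      by (simp add: scaleR_diff_right)
    then have A: "norm ((x - a) /\<^sub>R l - (y - a) /\<^sub>R l) powr ?q = norm (x - y) powr ?q / l powr ?q"
      using l by (simp add: divide_inverse powr_mult inverse_powr mult.commute)
    have B: "\<bar>c * u ((x - a) /\<^sub>R l) - c * u ((y - a) /\<^sub>R l)\<bar>\<^sup>2 =
        c\<^sup>2 * \<bar>u ((x - a) /\<^sub>R l) - u ((y - a) /\<^sub>R l)\<bar>\<^sup>2"
      by (simp add: right_diff_distrib[symmetric] power_mult_distrib)
    have C: "l powr (- ?q) = 1 / l powr ?q"
      by (rule powr_minus_divide)
    show ?thesis
      unfolding A B C using l by simp
  qed
  have eq_f: "ennreal (\<bar>c * u ((x - a) /\<^sub>R l) - c * u ((y - a) /\<^sub>R l)\<bar>\<^sup>2 / norm (x - y) powr ?q) =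
      ennreal (c\<^sup>2 * l powr (- ?q)) * f ((x - a) /\<^sub>R l) ((y - a) /\<^sub>R l)" for x y :: "real^'n"
    unfolding eq f_def by (rule ennreal_mult) auto
  have "(gagliardo s (\<lambda>x. c * u ((x - a) /\<^sub>R l)))\<^sup>2 =
      (\<integral>\<^sup>+(x, y). ennreal (c\<^sup>2 * l powr (- ?q)) * f ((x - a) /\<^sub>R l) ((y - a) /\<^sub>R l)
        \<partial>(lborel \<Otimes>\<^sub>M lborel))"
    unfolding gagliardo_def epowr_half_squared eq_f ..
  also have "\<dots> = ennreal (c\<^sup>2 * l powr (- ?q)) *
      (ennreal (l ^ (2 * CARD('n))) * (\<integral>\<^sup>+(x, y). f x y \<partial>(lborel \<Otimes>\<^sub>M lborel)))"
  proof -
    have "(\<integral>\<^sup>+z. ennreal (c\<^sup>2 * l powr (- ?q)) *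
            (\<lambda>(x, y). f ((x - a) /\<^sub>R l) ((y - a) /\<^sub>R l)) z \<partial>(lborel \<Otimes>\<^sub>M lborel)) =
        ennreal (c\<^sup>2 * l powr (- ?q)) *
        (\<integral>\<^sup>+z. (\<lambda>(x, y). f ((x - a) /\<^sub>R l) ((y - a) /\<^sub>R l)) z \<partial>(lborel \<Otimes>\<^sub>M lborel))"
      by (rule nn_integral_cmult) measurable
    then show ?thesis
      using nn_integral_dilate_pair[OF meas l, of a] by (simp add: case_prod_unfold)
  qed
  also have "\<dots> = ennreal (c\<^sup>2 * l powr (real CARD('n) - 2 * s)) * (gagliardo s u)\<^sup>2"
  proof -
    have "l powr (- ?q) * l ^ (2 * CARD('n)) = l powr (real CARD('n) - 2 * s)"
      using l by (simp add: powr_realpow[symmetric] powr_add[symmetric])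
    then show ?thesis
      unfolding gagliardo_def epowr_half_squared f_def mult.assoc[symmetric]
      using l by (simp add: ennreal_mult[symmetric] mult.assoc)
  qed
  finally show ?thesis .
qed

section \<open>Finiteness of the Gagliardo seminorm\<close>

text \<open>The map \<open>z \<mapsto> q ^ k *\<^sub>R z\<close> carries the annulus \<open>1 \<le> norm z < 2\<close> onto the \<open>k\<close>-th annulus of the union. By
  homogeneity of the integrand it multiplies the integral by \<open>(q powr b) ^ k\<close>, so the integrals are
  summable. The choices \<open>q = 1/2\<close>, \<open>b > 0\<close> and \<open>q = 2\<close>, \<open>b < 0\<close> give integrability near \<open>0\<close> and near
  infinity.\<close>

lemma nn_integral_norm_powr_annuli_finite:
  fixes q b :: real
  assumes q: "q > 0" and b: "q powr b < 1"
  shows "(\<integral>\<^sup>+z::'a::euclidean_space\<in>(\<Union>k. {z. q ^ k \<le> norm z \<and> norm z < 2 * q ^ k}).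
           ennreal (norm z powr (b - real DIM('a))) \<partial>lborel) < \<infinity>"
proof -
  define A :: "real \<Rightarrow> 'a set" where "A r = {z. r \<le> norm z \<and> norm z < 2 * r}" for r
  define g :: "'a \<Rightarrow> ennreal" where "g z = ennreal (norm z powr (b - real DIM('a)))" for z
  define J where "J = (\<integral>\<^sup>+z\<in>A 1. g z \<partial>lborel)"
  have [measurable]: "A r \<in> sets borel" for r
    unfolding A_def by measurable
  have [measurable]: "g \<in> borel_measurable borel"
    unfolding g_def by measurable
  have J: "J < \<infinity>"
  proof -
    \<comment> \<open>On the annulus the power is largest at one of the two radii, according to the sign of the
      exponent.\<close>
    define M where "M = max 1 (2 powr (b - real DIM('a)))"
    have "g z * indicator (A 1) z \<le> ennreal M * indicator (cball 0 2) z" for z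
    proof (cases "z \<in> A 1")
      case True
      then have z: "1 \<le> norm z" "norm z < 2" by (auto simp: A_def)
      have "norm z powr (b - real DIM('a)) \<le> M"
      proof (cases "b - real DIM('a) \<ge> 0")
        case True
        then have "norm z powr (b - real DIM('a)) \<le> 2 powr (b - real DIM('a))"
          using z by (intro powr_mono2) auto
        then show ?thesis unfolding M_def by simp
      next
        case False
        then have "norm z powr (b - real DIM('a)) \<le> norm z powr 0"
          using z by (intro powr_mono) auto
        then show ?thesis unfolding M_def using z by (auto simp: le_max_iff_disj split: if_splits)
      qed
      then show ?thesis using z True by (simp add: g_def ennreal_leI)
    qed auto
    then have "J \<le> (\<integral>\<^sup>+z. ennreal M * indicator (cball 0 2) (z::'a) \<partial>lborel)"
      unfolding J_def by (intro nn_integral_mono)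
    also have "\<dots> = ennreal M * emeasure lborel (cball (0::'a) 2)"
      by (simp add: nn_integral_cmult_indicator)
    also have "\<dots> < \<infinity>"
      using emeasure_lborel_cball_finite[of "0::'a" 2] by (simp add: ennreal_mult_less_top)
    finally show ?thesis .
  qed
  have scale: "(\<integral>\<^sup>+z\<in>A r. g z \<partial>lborel) = ennreal (r powr b) * J" if r: "r > 0" for r
  proof -
    have "(\<integral>\<^sup>+z\<in>A r. g z \<partial>lborel) =
        ennreal (r ^ DIM('a)) * (\<integral>\<^sup>+z. g (r *\<^sub>R z) * indicator (A r) (r *\<^sub>R z) \<partial>lborel)"
      using nn_integral_affine[of "\<lambda>z. g z * indicator (A r) z" r 0] r by simp
    also have "(\<lambda>z. g (r *\<^sub>R z) * indicator (A r) (r *\<^sub>R z)) =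
        (\<lambda>z. ennreal (r powr (b - real DIM('a))) * (g z * indicator (A 1) z))"
    proof
      fix z
      have "r *\<^sub>R z \<in> A r \<longleftrightarrow> z \<in> A 1"
        using r by (auto simp: A_def)
      then show "g (r *\<^sub>R z) * indicator (A r) (r *\<^sub>R z) =
          ennreal (r powr (b - real DIM('a))) * (g z * indicator (A 1) z)"
        using r by (auto simp: g_def powr_mult ennreal_mult indicator_def)
    qed
    also have "ennreal (r ^ DIM('a)) *
        (\<integral>\<^sup>+z. ennreal (r powr (b - real DIM('a))) * (g z * indicator (A 1) z) \<partial>lborel) =
        ennreal (r ^ DIM('a) * r powr (b - real DIM('a))) * J"
      using r by (subst nn_integral_cmult) (auto simp: J_def ennreal_mult mult.assoc)
    also have "r ^ DIM('a) * r powr (b - real DIM('a)) = r powr b"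
      using r by (simp add: powr_realpow[symmetric] powr_add[symmetric])
    finally show ?thesis .
  qed
  have "(\<integral>\<^sup>+z\<in>(\<Union>k. A (q ^ k)). g z \<partial>lborel) \<le>
      (\<integral>\<^sup>+z. (\<Sum>k. g z * indicator (A (q ^ k)) z) \<partial>lborel)"
  proof (intro nn_integral_mono)
    fix z
    show "g z * indicator (\<Union>k. A (q ^ k)) z \<le> (\<Sum>k. g z * indicator (A (q ^ k)) z)"
    proof (cases "z \<in> (\<Union>k. A (q ^ k))")
      case True
      then obtain k where k: "z \<in> A (q ^ k)" by auto
      have "(\<Sum>i\<in>{k}. g z * indicator (A (q ^ i)) z) \<le> (\<Sum>i. g z * indicator (A (q ^ i)) z)"
        by (rule sum_le_suminf) auto
      then show ?thesis using k True by simp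
    qed auto
  qed
  also have "\<dots> = (\<Sum>k. \<integral>\<^sup>+z\<in>A (q ^ k). g z \<partial>lborel)"
    by (rule nn_integral_suminf) measurable
  also have "\<dots> = (\<Sum>k. ennreal ((q powr b) ^ k)) * J"
    using q by (simp add: scale powr_realpow[symmetric] powr_powr mult.commute)
  also have "\<dots> < \<infinity>"
  proof -
    have "summable (\<lambda>k. (q powr b) ^ k)"
      using b by (intro summable_geometric) simp
    then have "(\<Sum>k. ennreal ((q powr b) ^ k)) < \<infinity>"
      by (simp add: suminf_ennreal2 less_top[symmetric])
    then show ?thesis using J by (simp add: ennreal_mult_less_top)
  qed
  finally show ?thesis by (simp add: A_def g_def)
qed

lemma nn_integral_norm_powr_near_finite:
  assumes b: "b > 0"
  shows "(\<integral>\<^sup>+z::'a::euclidean_space\<in>{z. norm z < 1}. ennreal (norm z powr (b - real DIM('a))) \<partial>lborel) < \<infinity>"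
proof (rule le_less_trans[OF nn_integral_mono])
  have "(1/2::real) powr b < 1"
    using b by (simp add: powr_divide)
  then show "(\<integral>\<^sup>+z::'a\<in>(\<Union>k. {z. (1/2) ^ k \<le> norm z \<and> norm z < 2 * (1/2) ^ k}).
           ennreal (norm z powr (b - real DIM('a))) \<partial>lborel) < \<infinity>"
    by (intro nn_integral_norm_powr_annuli_finite) auto
  fix z :: 'a
  have "z \<in> (\<Union>k. {z. (1/2) ^ k \<le> norm z \<and> norm z < 2 * (1/2) ^ k})"
    if z: "z \<noteq> 0" "norm z < 1"
  proof -
    have ex: "\<exists>k. (1/2::real) ^ k \<le> norm z"
      using real_arch_pow_inv[of "norm z" "1/2"] z by (auto intro: less_imp_le)
    define k where "k = (LEAST k. (1/2::real) ^ k \<le> norm z)"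
    have k: "(1/2::real) ^ k \<le> norm z"
      unfolding k_def using ex by (rule LeastI_ex)
    then have "k \<noteq> 0" using z by (cases k) auto
    then obtain j where j: "k = Suc j" by (cases k) auto
    then have "\<not> (1/2::real) ^ j \<le> norm z"
      using not_less_Least[of j "\<lambda>k. (1/2::real) ^ k \<le> norm z"] by (simp add: k_def)
    then show ?thesis using k j by (intro UN_I[of k]) auto
  qed
  \<comment> \<open>The origin lies in no annulus, but there both sides vanish because \<open>0 powr p = 0\<close>.\<close>
  then show "ennreal (norm z powr (b - real DIM('a))) * indicator {z. norm z < 1} z \<le>
      ennreal (norm z powr (b - real DIM('a))) *
        indicator (\<Union>k. {z. (1/2) ^ k \<le> norm z \<and> norm z < 2 * (1/2) ^ k}) z"
    by (cases "z = 0") (auto simp: indicator_def)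
qed

lemma nn_integral_norm_powr_far_finite:
  assumes b: "b < 0"
  shows "(\<integral>\<^sup>+z::'a::euclidean_space\<in>{z. 1 \<le> norm z}. ennreal (norm z powr (b - real DIM('a))) \<partial>lborel) < \<infinity>"
proof (rule le_less_trans[OF nn_integral_mono])
  have "(2::real) powr b < 1"
    using b by (simp add: powr_less_one)
  then show "(\<integral>\<^sup>+z::'a\<in>(\<Union>k. {z. 2 ^ k \<le> norm z \<and> norm z < 2 * 2 ^ k}).
           ennreal (norm z powr (b - real DIM('a))) \<partial>lborel) < \<infinity>"
    by (intro nn_integral_norm_powr_annuli_finite) auto
  fix z :: 'a
  have "z \<in> (\<Union>k. {z. 2 ^ k \<le> norm z \<and> norm z < 2 * 2 ^ k})"
    if z: "1 \<le> norm z"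
  proof -
    have ex: "\<exists>k. norm z < (2::real) ^ k"
      using real_arch_pow[of 2 "norm z"] by auto
    define k where "k = (LEAST k. norm z < (2::real) ^ k)"
    have k: "norm z < (2::real) ^ k"
      unfolding k_def using ex by (rule LeastI_ex)
    then have "k \<noteq> 0" using z by (cases k) auto
    then obtain j where j: "k = Suc j" by (cases k) auto
    then have "\<not> norm z < (2::real) ^ j"
      using not_less_Least[of j "\<lambda>k. norm z < (2::real) ^ k"] by (simp add: k_def)
    then show ?thesis using k j by (intro UN_I[of j]) auto
  qed
  then show "ennreal (norm z powr (b - real DIM('a))) * indicator {z. 1 \<le> norm z} z \<le>
      ennreal (norm z powr (b - real DIM('a))) *
        indicator (\<Union>k. {z. 2 ^ k \<le> norm z \<and> norm z < 2 * 2 ^ k}) z"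
    by (auto simp: indicator_def)
qed

lemma frechet_derivative_eq_grad:
  fixes u :: "real^'n::finite \<Rightarrow> real"
  assumes "u differentiable_on UNIV"
  shows "frechet_derivative u (at x) h = grad u x \<bullet> h"
proof -
  have lin: "linear (frechet_derivative u (at x))"
    using assms by (simp add: differentiable_on_def linear_frechet_derivative)
  have "(\<Sum>i\<in>UNIV. h $ i *\<^sub>R axis i 1) = h"
    using basis_expansion[of h] by (simp add: scalar_mult_eq_scaleR)
  then have "frechet_derivative u (at x) h =
      frechet_derivative u (at x) (\<Sum>i\<in>UNIV. h $ i *\<^sub>R axis i 1)"
    by simp
  also have "\<dots> = (\<Sum>i\<in>UNIV. h $ i * frechet_derivative u (at x) (axis i 1))"
    by (simp add: linear_sum[OF lin] linear_scale[OF lin])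
  finally show ?thesis
    by (simp add: grad_def partial_deriv_def inner_vec_def mult.commute)
qed

lemma C1_Lipschitz_on_cball:
  fixes u :: "real^'n::finite \<Rightarrow> real"
  assumes u: "u differentiable_on UNIV" and g: "continuous_on UNIV (grad u)"
  obtains L where "L \<ge> 0"
    "\<And>x y. norm x \<le> r \<Longrightarrow> norm y \<le> r \<Longrightarrow> \<bar>u x - u y\<bar> \<le> L * norm (x - y)"
proof -
  have "compact (grad u ` cball 0 r)"
    using g continuous_on_subset by (intro compact_continuous_image) auto
  then obtain L where L: "L > 0" "\<And>x. norm x \<le> r \<Longrightarrow> norm (grad u x) \<le> L"
    by (auto dest!: compact_imp_bounded simp: bounded_pos)
  have bound: "norm (u x - u y) \<le> L * norm (x - y)" if "norm x \<le> r" "norm y \<le> r" for x y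
  proof (rule differentiable_bound[of "cball 0 r" u "\<lambda>x. frechet_derivative u (at x)"])
    fix z :: "real^'n" assume z: "z \<in> cball 0 r"
    show "(u has_derivative frechet_derivative u (at z)) (at z within cball 0 r)"
      using u by (auto simp: differentiable_on_def frechet_derivative_works[symmetric]
        intro: has_derivative_at_withinI)
    show "onorm (frechet_derivative u (at z)) \<le> L"
    proof (rule onorm_le)
      fix h
      have "norm (grad u z \<bullet> h) \<le> norm (grad u z) * norm h"
        by (simp add: Cauchy_Schwarz_ineq2)
      also have "\<dots> \<le> L * norm h"
        using L z by (intro mult_right_mono) auto
      finally show "norm (frechet_derivative u (at z) h) \<le> L * norm h"
        by (simp add: frechet_derivative_eq_grad[OF u])
    qed
  qed (use that in auto)
  show thesis
    by (rule that[of L]) (use L(1) bound in auto)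
qed

text \<open>The numerator vanishes unless \<open>x\<close> or \<open>y\<close> lies in a ball \<open>B\<close> containing the support. So the
  integrand is at most \<open>indicator B x * G (x - y) + indicator B y * G (x - y)\<close> with an integrable \<open>G\<close>,
  and each of these two terms has integral \<open>emeasure lborel B\<close> times that of \<open>G\<close>.\<close>

lemma gagliardo_finite:
  fixes u :: "real^'n::finite \<Rightarrow> real"
  assumes u: "u \<in> Cc_infinity \<Omega>" and s: "0 < s" "s < 1"
  shows "(gagliardo s u)\<^sup>2 < \<infinity>"
proof -
  let ?n = "real CARD('n)"
  have sm: "smooth u" and K: "compact (closure {x. u x \<noteq> 0})"
    using u by (auto simp: Cc_infinity_def)
  have cont: "continuous_on UNIV u" by (rule smooth_continuous[OF sm])
  then have [measurable]: "u \<in> borel_measurable borel"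
    by (rule borel_measurable_continuous_onI)
  obtain R where R: "\<And>x. u x \<noteq> 0 \<Longrightarrow> norm x \<le> R"
    using bounded_subset[OF compact_imp_bounded[OF K] closure_subset] by (auto simp: bounded_iff)
  \<comment> \<open>The Lipschitz bound is used for points at distance below \<open>1\<close>, one of them of norm at most \<open>R\<close>.\<close>
  obtain L where L: "L \<ge> 0"
    "\<And>x y. norm x \<le> R + 1 \<Longrightarrow> norm y \<le> R + 1 \<Longrightarrow> \<bar>u x - u y\<bar> \<le> L * norm (x - y)"
    using C1_Lipschitz_on_cball[OF smooth_differentiable[OF sm] smooth_grad_continuous[OF sm]]
    by blast
  have "compact (u ` cball 0 R)"
    using cont continuous_on_subset by (intro compact_continuous_image) auto
  then obtain M where M: "M > 0" "\<And>x. norm x \<le> R \<Longrightarrow> \<bar>u x\<bar> \<le> M"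
    by (auto dest!: compact_imp_bounded simp: bounded_pos)
  have M': "\<bar>u x\<bar> \<le> M" for x
    using M R[of x] by (cases "u x = 0") auto
  define G :: "real^'n \<Rightarrow> ennreal" where
    "G z = ennreal (L\<^sup>2) * (ennreal (norm z powr (2 - 2 * s - ?n)) * indicator {z. norm z < 1} z)
         + ennreal ((2 * M)\<^sup>2) * (ennreal (norm z powr (- 2 * s - ?n)) * indicator {z. 1 \<le> norm z} z)"
    for z
  have [measurable]: "G \<in> borel_measurable borel"
    unfolding G_def by measurable
  have Gfin: "(\<integral>\<^sup>+z. G z \<partial>lborel) < \<infinity>"
    using nn_integral_norm_powr_near_finite[of "2 - 2 * s", where 'a = "real^'n"]
      nn_integral_norm_powr_far_finite[of "- 2 * s", where 'a = "real^'n"] s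
    unfolding G_def
    by (subst nn_integral_add) (auto simp: nn_integral_cmult ennreal_mult_less_top)
  define B where "B = cball (0::real^'n) R"
  have [measurable]: "B \<in> sets borel" by (simp add: B_def)
  have bound: "ennreal (\<bar>u x - u y\<bar>\<^sup>2 / norm (x - y) powr (?n + 2 * s)) \<le>
      indicator B x * G (x - y) + indicator B y * G (x - y)" for x y
  proof (cases "u x = u y")
    case False
    then have "x \<in> B \<or> y \<in> B"
      using R[of x] R[of y] by (cases "u x = 0") (auto simp: B_def)
    then have one: "G (x - y) \<le> indicator B x * G (x - y) + indicator B y * G (x - y)"
      by (auto simp: indicator_def)
    from False have pos: "norm (x - y) > 0" by auto
    have "ennreal (\<bar>u x - u y\<bar>\<^sup>2 / norm (x - y) powr (?n + 2 * s)) \<le> G (x - y)"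
    proof (cases "norm (x - y) < 1")
      case True
      have "norm x \<le> R + 1" "norm y \<le> R + 1"
        using \<open>x \<in> B \<or> y \<in> B\<close> True norm_triangle_sub[of x y] norm_triangle_sub[of y x]
        by (auto simp: B_def norm_minus_commute)
      then have "\<bar>u x - u y\<bar>\<^sup>2 \<le> (L * norm (x - y))\<^sup>2"
        using L by (intro power_mono) auto
      then have "\<bar>u x - u y\<bar>\<^sup>2 / norm (x - y) powr (?n + 2 * s) \<le>
          (L * norm (x - y))\<^sup>2 / norm (x - y) powr (?n + 2 * s)"
        by (intro divide_right_mono) auto
      also have "\<dots> = L\<^sup>2 * (norm (x - y) powr 2 / norm (x - y) powr (?n + 2 * s))"
        by (simp add: power_mult_distrib)
      also have "norm (x - y) powr 2 / norm (x - y) powr (?n + 2 * s) =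
          norm (x - y) powr (2 - 2 * s - ?n)"
      proof -
        have "2 - 2 * s - ?n = 2 - (?n + 2 * s)" by simp
        then show ?thesis by (simp only: powr_diff)
      qed
      finally show ?thesis
        using True by (simp add: G_def ennreal_mult[symmetric] ennreal_leI)
    next
      case far: False
      have "\<bar>u x - u y\<bar> \<le> 2 * M" using M'[of x] M'[of y] by linarith
      then have "\<bar>u x - u y\<bar>\<^sup>2 \<le> (2 * M)\<^sup>2"
        by (intro power_mono) auto
      then have "\<bar>u x - u y\<bar>\<^sup>2 / norm (x - y) powr (?n + 2 * s) \<le>
          (2 * M)\<^sup>2 / norm (x - y) powr (?n + 2 * s)"
        by (intro divide_right_mono) auto
      also have "\<dots> = (2 * M)\<^sup>2 * norm (x - y) powr (- 2 * s - ?n)"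
      proof -
        have "- 2 * s - ?n = - (?n + 2 * s)" by simp
        then show ?thesis by (simp only: powr_minus_divide) simp
      qed
      finally show ?thesis
        using far by (simp add: G_def ennreal_mult[symmetric] ennreal_leI)
    qed
    with one show ?thesis by (rule order_trans[rotated])
  qed auto
  have inner1: "(\<integral>\<^sup>+y. G (x - y) \<partial>lborel) = (\<integral>\<^sup>+z. G z \<partial>lborel)" for x
    using nn_integral_affine[of G "-1" x] by simp
  have inner2: "(\<integral>\<^sup>+x. G (x - y) \<partial>lborel) = (\<integral>\<^sup>+z. G z \<partial>lborel)" for y
    using nn_integral_affine[of G 1 "- y"] by simp
  have "(gagliardo s u)\<^sup>2 \<le> (\<integral>\<^sup>+(x, y). indicator B x * G (x - y) + indicator B y * G (x - y)
      \<partial>(lborel \<Otimes>\<^sub>M lborel))"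
    unfolding gagliardo_def epowr_half_squared
    by (intro nn_integral_mono) (use bound in auto)
  also have "\<dots> = (\<integral>\<^sup>+(x, y). indicator B x * G (x - y) \<partial>(lborel \<Otimes>\<^sub>M lborel)) +
      (\<integral>\<^sup>+(x, y). indicator B y * G (x - y) \<partial>(lborel \<Otimes>\<^sub>M lborel))"
    unfolding case_prod_beta by (rule nn_integral_add) measurable
  also have "(\<integral>\<^sup>+(x, y). indicator B x * G (x - y) \<partial>(lborel \<Otimes>\<^sub>M lborel)) =
      (\<integral>\<^sup>+x. \<integral>\<^sup>+y. indicator B x * G (x - y) \<partial>lborel \<partial>lborel)"
    by (rule nn_integral_lborel_pair_iterated(1)) measurable
  also have "\<dots> = emeasure lborel B * (\<integral>\<^sup>+z. G z \<partial>lborel)"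
    by (simp add: nn_integral_cmult inner1 nn_integral_multc)
  also have "(\<integral>\<^sup>+(x, y). indicator B y * G (x - y) \<partial>(lborel \<Otimes>\<^sub>M lborel)) =
      (\<integral>\<^sup>+y. \<integral>\<^sup>+x. indicator B y * G (x - y) \<partial>lborel \<partial>lborel)"
    by (rule nn_integral_lborel_pair_iterated(2)) measurable
  also have "\<dots> = emeasure lborel B * (\<integral>\<^sup>+z. G z \<partial>lborel)"
    by (simp add: nn_integral_cmult inner2 nn_integral_multc)
  also have "emeasure lborel B * (\<integral>\<^sup>+z. G z \<partial>lborel) + emeasure lborel B * (\<integral>\<^sup>+z. G z \<partial>lborel) < \<infinity>"
    using Gfin emeasure_lborel_cball_finite[of "0::real^'n" R]
    by (simp add: B_def ennreal_mult_less_top)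
  finally show ?thesis .
qed

section \<open>Equality of the two constants\<close>

text \<open>The competitor is \<open>u\<close> dilated by \<open>l\<close> about \<open>a\<close> with amplitude \<open>l powr (- (n - 2) / 2)\<close>, the only
  positive one that preserves the critical norm.\<close>

lemma mixed_sobolev_const_le_concentrated:
  fixes u :: "real^'n::finite \<Rightarrow> real" and \<Omega> :: "(real^'n) set"
  assumes n: "CARD('n) \<ge> 3"
    and u: "u \<in> Cc_infinity UNIV" and norm1: "Lp_norm (crit_exp TYPE('n)) u = 1"
    and R: "\<And>x. u x \<noteq> 0 \<Longrightarrow> norm x \<le> R"
    and l: "l > 0" and sub: "cball a (l * R) \<subseteq> \<Omega>"
  shows "mixed_sobolev_const s \<Omega> \<le>
    (Lp_norm 2 (grad u))\<^sup>2 + ennreal (l powr (2 - 2 * s)) * (gagliardo s u)\<^sup>2"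
proof -
  define n where "n = real CARD('n)"
  have n3: "n \<ge> 3" using n by (simp add: n_def)
  define c where "c = l powr (- (n - 2) / 2)"
  have c: "c > 0" using l by (simp add: c_def)
  define v where "v = (\<lambda>x. c * u ((x - a) /\<^sub>R l))"
  have sm: "smooth u" using u by (simp add: Cc_infinity_def)
  have ln: "l ^ CARD('n) = l powr n"
    using l by (simp add: n_def powr_realpow)
  have vC: "v \<in> Cc_infinity \<Omega>"
    unfolding v_def by (rule Cc_infinity_dilate[OF u R l sub])
  have "Lp_norm (crit_exp TYPE('n)) v = Lp_norm (crit_exp TYPE('n)) u"
  proof (rule Lp_norm_dilate[where a = a, OF smooth_continuous[OF sm] l])
    have "- (n - 2) / 2 * crit_exp TYPE('n) = - n"
      using n3 by (simp add: crit_exp_def n_def[symmetric] field_simps)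
    then show "l ^ CARD('n) * \<bar>c\<bar> powr crit_exp TYPE('n) = 1"
      using l by (simp add: c_def powr_powr ln powr_add[symmetric])
  qed (simp add: v_def)
  then have norm_v: "Lp_norm (crit_exp TYPE('n)) v = 1" using norm1 by simp
  have grad_v: "Lp_norm 2 (grad v) = Lp_norm 2 (grad u)"
  proof (rule Lp_norm_dilate[where a = a, OF smooth_grad_continuous[OF sm] l])
    have "c / l = l powr (- n / 2)"
    proof -
      have "- n / 2 = - (n - 2) / 2 - 1" by (simp add: field_simps)
      then show ?thesis using l by (simp only: powr_diff c_def) simp
    qed
    then show "l ^ CARD('n) * \<bar>c / l\<bar> powr 2 = 1"
      using l unfolding ln by (simp add: powr_powr powr_add[symmetric] del: powr_numeral)
  qed (simp add: v_def grad_dilate smooth_differentiable[OF sm])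
  have "c\<^sup>2 * l powr (n - 2 * s) = l powr (2 - 2 * s)"
    using l by (simp add: c_def powr_power powr_add[symmetric] diff_divide_distrib)
  then have gag_v: "(gagliardo s v)\<^sup>2 = ennreal (l powr (2 - 2 * s)) * (gagliardo s u)\<^sup>2"
    unfolding v_def using gagliardo_dilate[OF smooth_continuous[OF sm] l, of s c a]
    by (simp add: n_def)
  have "mixed_sobolev_const s \<Omega> \<le> rho_sq s v"
    unfolding mixed_sobolev_const_def using vC norm_v by (intro Inf_lower) auto
  then show ?thesis by (simp add: rho_sq_def grad_v gag_v)
qed

lemma mixed_sobolev_const_le_grad:
  fixes u :: "real^'n::finite \<Rightarrow> real" and \<Omega> :: "(real^'n) set"
  assumes n: "CARD('n) \<ge> 3" and s: "0 < s" "s < 1"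
    and \<Omega>: "open \<Omega>" "\<Omega> \<noteq> {}"
    and u: "u \<in> Cc_infinity UNIV" and norm1: "Lp_norm (crit_exp TYPE('n)) u = 1"
  shows "mixed_sobolev_const s \<Omega> \<le> (Lp_norm 2 (grad u))\<^sup>2"
proof -
  obtain a r where r: "r > 0" "cball a r \<subseteq> \<Omega>"
    using \<Omega> open_contains_cball by blast
  have "bounded (closure {x. u x \<noteq> 0})"
    using u unfolding Cc_infinity_def by (blast intro: compact_imp_bounded)
  then have "bounded {x. u x \<noteq> 0}"
    by (rule bounded_subset[OF _ closure_subset])
  then obtain R where R: "R > 0" "\<And>x. u x \<noteq> 0 \<Longrightarrow> norm x \<le> R"
    by (auto simp: bounded_pos)
  obtain b where b: "(gagliardo s u)\<^sup>2 = ennreal b" "b \<ge> 0"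
    using gagliardo_finite[OF u s] by (cases "(gagliardo s u)\<^sup>2") auto
  let ?A = "(Lp_norm 2 (grad u))\<^sup>2"
  have "((\<lambda>l. l powr (2 - 2 * s) * b) \<longlongrightarrow> 0) (at_right 0)"
    using s by (auto intro!: tendsto_eq_intros simp: eventually_at_right_less less_imp_le
      eventually_mono[OF eventually_at_right_less])
  then have "((\<lambda>l. ?A + ennreal (l powr (2 - 2 * s) * b)) \<longlongrightarrow> ?A + ennreal 0) (at_right 0)"
    by (intro tendsto_add tendsto_const tendsto_ennrealI)
  then have lim: "((\<lambda>l. ?A + ennreal (l powr (2 - 2 * s) * b)) \<longlongrightarrow> ?A) (at_right 0)"
    by simp
  have "eventually (\<lambda>l. l \<in> {0<..<r / R}) (at_right (0::real))"
    using r R by (intro eventually_at_right_real) auto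
  then have "eventually (\<lambda>l. mixed_sobolev_const s \<Omega> \<le> ?A + ennreal (l powr (2 - 2 * s) * b)) (at_right 0)"
  proof eventually_elim
    case (elim l)
    then have "cball a (l * R) \<subseteq> cball a r"
      using R by (intro subset_cball) (auto simp: field_simps)
    then have "cball a (l * R) \<subseteq> \<Omega>" using r by simp
    from mixed_sobolev_const_le_concentrated[OF n u norm1 R(2) _ this, of s] elim
    show ?case by (simp add: b ennreal_mult)
  qed
  then show ?thesis
    by (rule tendsto_lowerbound[OF lim]) simp
qed

theorem theorem1p1:
  fixes \<Omega> :: "(real^'n::finite) set" and s :: real
  assumes "CARD('n) \<ge> 3"
    and "0 < s" and "s < 1"
    and "open \<Omega>" and "\<Omega> \<noteq> {}"
  shows "mixed_sobolev_const s \<Omega> = sobolev_const TYPE('n)"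
proof (rule antisym)
  show "mixed_sobolev_const s \<Omega> \<le> sobolev_const TYPE('n)"
    unfolding sobolev_const_def
    by (rule Inf_greatest) (use mixed_sobolev_const_le_grad[OF assms] in auto)
  show "sobolev_const TYPE('n) \<le> mixed_sobolev_const s \<Omega>"
    unfolding mixed_sobolev_const_def
  proof (rule Inf_greatest, clarify)
    fix u :: "real^'n \<Rightarrow> real"
    assume "u \<in> Cc_infinity \<Omega>" "Lp_norm (crit_exp TYPE('n)) u = 1"
    then have "sobolev_const TYPE('n) \<le> (Lp_norm 2 (grad u))\<^sup>2"
      unfolding sobolev_const_def by (intro Inf_lower) (auto simp: Cc_infinity_def)
    then show "sobolev_const TYPE('n) \<le> rho_sq s u"
      unfolding rho_sq_def by (rule order_trans) simp
  qed
qed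

end
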